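(* Let $p$ be an odd prime, let $a_i,b_i\in\mathbb Z$ for $i=1,\dots,m$, let $c_1,\dots,c_m$ be complex numbers, and set $$c=\sum_{s=1}^m c_s\left(\frac{a_s}p\right)\cdot\sum_{t=1}^m c_t\left(\frac{b_t}p\right).$$ Write $f(j,k)=\sum_{i=1}^m c_i\left(\frac{a_ij+b_ik}p\right)$. Let $x,y,z$ be complex numbers. (i) For each $n\in\{1,\dots,p-1\}$, $$\det\left[f(j,k)+\left(\frac{jk}p\right)x\right]_{0\le j,k\le n}=\det\left[f(j,k)\right]_{0\le j,k\le n}$$ and $$c\det\left[f(j,k)+\left(\frac{jk}p\right)x\right]_{1\le j,k\le n}=c\det\left[f(j,k)\right]_{1\le j,k\le n}-x\det\left[f(j,k)\right]_{0\le j,k\le n}.$$ (ii) For any positive integer $n$, $$\begin{aligned}&c\det\left[x+f(j,k)+\left(\frac jp\right)y+\left(\frac kp\right)z\right]_{0\le j,k\le n}\\ &=\Big(y+\sum_{i=1}^m c_i\left(\frac{a_i}p\right)\Big)\Big(z+\sum_{i=1}^m c_i\left(\frac{b_i}p\right)\Big)\det\left[f(j,k)\right]_{0\le j,k\le n}\\ &\quad+cx\det\left[f(j,k)-\sum_{i=1}^m c_i\left(\frac{a_i}p\right)\left(\frac jp\right)-\sum_{i=1}^m c_i\left(\frac{b_i}p\right)\left(\frac kp\right)\right]_{1\le j,k\le n}.\end{aligned}$$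
   Context: $\left(\frac{\cdot}{p}\right)$ denotes the Legendre symbol modulo $p$, with $\left(\frac{a}{p}\right)=0$ when $p\mid a$. *)

theory Defs
  imports
    "HOL-Number_Theory.Number_Theory"
    "Jordan_Normal_Form.Determinant"
    "HOL.Complex"
begin

abbreviation legendre_symb :: "int \<Rightarrow> nat \<Rightarrow> complex" where
  "legendre_symb a p \<equiv> of_int (Legendre a (int p))"

text \<open>The determinant of the square matrix with entries \<open>g j k\<close>, where both \<open>j\<close> and \<open>k\<close> run over
  \<open>l, \<dots>, n\<close>. Matrix indices in the library start at \<open>0\<close>, hence the shift by \<open>l\<close>.\<close>
definition det_range :: "nat \<Rightarrow> nat \<Rightarrow> (int \<Rightarrow> int \<Rightarrow> complex) \<Rightarrow> complex" where
  "det_range l n g =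
     det (mat (n + 1 - l) (n + 1 - l) (\<lambda>(j, k). g (int (j + l)) (int (k + l))))"

definition leg_sum ::
  "nat \<Rightarrow> nat \<Rightarrow> (nat \<Rightarrow> complex) \<Rightarrow> (nat \<Rightarrow> int) \<Rightarrow> complex" where
  "leg_sum p m c a = (\<Sum>i = 1..m. c i * legendre_symb (a i) p)"

definition leg_form ::
  "nat \<Rightarrow> nat \<Rightarrow> (nat \<Rightarrow> complex) \<Rightarrow> (nat \<Rightarrow> int) \<Rightarrow> (nat \<Rightarrow> int) \<Rightarrow> int \<Rightarrow> int \<Rightarrow> complex" where
  "leg_form p m c a b j k = (\<Sum>i = 1..m. c i * legendre_symb (a i * j + b i * k) p)"

end

theory Submission
  imports Defs
begin

text \<open>
  Write \<open>u\<close> for the vector of Legendre symbols of \<open>1, \<dots>, n\<close>, \<open>A\<close> and \<open>B\<close> for the two factors of \<open>c\<close>,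
  and \<open>M\<close> for the matrix of \<open>f\<close> on \<open>1, \<dots>, n\<close>. The matrix of \<open>f\<close> on \<open>0, \<dots>, n\<close> is \<open>M\<close> bordered by the
  row \<open>B u\<close>, the column \<open>A u\<close> and the corner \<open>0\<close>, so its determinant is \<open>c\<close> times the determinant \<open>E\<close>
  of \<open>M\<close> bordered by \<open>u\<close>, \<open>u\<close>, \<open>0\<close>. Elementary operations with the border row and column do not
  change \<open>E\<close>, so that \<open>E\<close> depends on \<open>M\<close> only modulo multiples of the row and the column \<open>u\<close>;
  linearity in the corner entry produces the remaining terms.
\<close>

definition bordered ::
  "nat \<Rightarrow> 'a \<Rightarrow> (nat \<Rightarrow> 'a) \<Rightarrow> (nat \<Rightarrow> 'a) \<Rightarrow> (nat \<Rightarrow> nat \<Rightarrow> 'a) \<Rightarrow> 'a mat" where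
  "bordered n d r w g = mat (Suc n) (Suc n) (\<lambda>(j, k).
     case j of 0 \<Rightarrow> (case k of 0 \<Rightarrow> d | Suc k' \<Rightarrow> r k')
     | Suc j' \<Rightarrow> (case k of 0 \<Rightarrow> w j' | Suc k' \<Rightarrow> g j' k'))"

lemma bordered_carrier [simp]: "bordered n d r w g \<in> carrier_mat (Suc n) (Suc n)"
  by (simp add: bordered_def)

lemma transpose_bordered: "(bordered n d r w g)\<^sup>T = bordered n d w r (\<lambda>j k. g k j)"
  by (rule eq_matI) (auto simp: bordered_def split: nat.splits)

lemma det_bordered_transpose:
  fixes d :: "'a :: comm_ring_1"
  shows "det (bordered n d w r (\<lambda>j k. g k j)) = det (bordered n d r w g)"
  by (metis bordered_carrier det_transpose transpose_bordered)

lemma mat_eq_bordered: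
  "mat (Suc n) (Suc n) (\<lambda>(j, k). h j k) =
     bordered n (h 0 0) (\<lambda>k. h 0 (Suc k)) (\<lambda>j. h (Suc j) 0) (\<lambda>j k. h (Suc j) (Suc k))"
  by (rule eq_matI) (auto simp: bordered_def split: nat.splits)

text \<open>Left multiplication by the lower triangular matrix with diagonal \<open>s\<close>, 1,
  ..., 1 and first column continued by \<open>v\<close> scales the border row by \<open>s\<close>
  and adds \<open>v j\<close> times the unscaled border row to row \<open>j\<close>. Nothing is
  divided by \<open>s\<close>, so \<open>s\<close> may be 0.\<close>

lemma det_bordered_row_op:
  fixes s d :: "'a :: comm_ring_1"
  shows "det (bordered n (s * d) (\<lambda>k. s * r k) (\<lambda>j. w j + v j * d) (\<lambda>j k. g j k + v j * r k)) =
     s * det (bordered n d r w g)"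
proof -
  let ?P = "bordered n s (\<lambda>_. 0) v (\<lambda>j k. if j = k then 1 else 0)"
  have "diag_mat ?P = s # replicate n 1"
    by (rule nth_equalityI) (auto simp: diag_mat_def bordered_def nth_Cons simp del: upt_Suc
        split: nat.splits)
  moreover have "?P $$ (i, j) = 0" if "i < j" "j < Suc n" for i j
    using that by (auto simp: bordered_def split: nat.splits)
  ultimately have "det ?P = s"
    using det_lower_triangular[of "Suc n" ?P] by simp
  moreover have "bordered n (s * d) (\<lambda>k. s * r k) (\<lambda>j. w j + v j * d) (\<lambda>j k. g j k + v j * r k) =
      ?P * bordered n d r w g"
    by (rule eq_matI)
      (auto simp: bordered_def scalar_prod_def sum.atLeast0_lessThan_Suc_shift
        if_distrib[of "\<lambda>t. t * _"] sum.delta simp del: sum.op_ivl_Suc split: nat.splits cong: if_cong)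
  ultimately show ?thesis
    by (simp add: det_mult[of _ "Suc n"])
qed

lemma det_bordered_col_op:
  fixes s d :: "'a :: comm_ring_1"
  shows "det (bordered n (s * d) (\<lambda>k. r k + v k * d) (\<lambda>j. s * w j) (\<lambda>j k. g j k + v k * w j)) =
     s * det (bordered n d r w g)"
  using det_bordered_row_op[of n s d w r v "\<lambda>j k. g k j"]
    det_bordered_transpose[of n d w r g]
    det_bordered_transpose[of n "s * d" "\<lambda>j. s * w j" "\<lambda>k. r k + v k * d"
      "\<lambda>j k. g j k + v k * w j"]
  by simp

text \<open>In the Laplace expansion along row 0 the corner occurs only as a coefficient, never in a
  cofactor. So the determinant is affine in it, with slope the core determinant.\<close>

lemma det_bordered_corner:
  fixes d :: "'a :: comm_ring_1"
  shows "det (bordered n (x + d) r w g) =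
     x * det (mat n n (\<lambda>(j, k). g j k)) + det (bordered n d r w g)"
proof -
  \<comment> \<open>Deleting row 0 removes the corner, so every cofactor may be taken at corner 0,
    whatever \<open>e\<close> is.\<close>
  have del: "mat_delete (bordered n e r w g) 0 k = mat_delete (bordered n 0 r w g) 0 k" for e k
    by (rule eq_matI) (auto simp: mat_delete_def bordered_def split: nat.splits)
  have "mat_delete (bordered n 0 r w g) 0 0 = mat n n (\<lambda>(j, k). g j k)"
    by (rule eq_matI) (auto simp: mat_delete_def bordered_def)
  then have cof: "cofactor (bordered n 0 r w g) 0 0 = det (mat n n (\<lambda>(j, k). g j k))"
    by (simp add: cofactor_def)
  have "det (bordered n e r w g) = e * det (mat n n (\<lambda>(j, k). g j k)) +
      (\<Sum>k<n. r k * cofactor (bordered n 0 r w g) 0 (Suc k))" for e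
  proof -
    have "det (bordered n e r w g) =
        (\<Sum>k<Suc n. bordered n e r w g $$ (0, k) * cofactor (bordered n 0 r w g) 0 k)"
      using laplace_expansion_row[OF bordered_carrier, of 0 n e r w g]
      by (simp add: cofactor_def del[of e])
    also have "\<dots> = e * cofactor (bordered n 0 r w g) 0 0 +
        (\<Sum>k<n. r k * cofactor (bordered n 0 r w g) 0 (Suc k))"
      by (subst sum.lessThan_Suc_shift) (simp add: bordered_def)
    finally show ?thesis by (simp add: cof)
  qed
  from this[of "x + d"] this[of d] show ?thesis
    by (simp add: algebra_simps)
qed

lemma det_bordered_scale:
  fixes \<alpha> \<beta> :: "'a :: comm_ring_1"
  shows "det (bordered n 0 (\<lambda>k. \<beta> * r k) (\<lambda>j. \<alpha> * w j) g) = \<alpha> * \<beta> * det (bordered n 0 r w g)"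
  using det_bordered_row_op[of n \<beta> 0 r "\<lambda>j. \<alpha> * w j" "\<lambda>_. 0" g]
    det_bordered_col_op[of n \<alpha> 0 r "\<lambda>_. 0" w g]
  by (simp add: mult_ac)

text \<open>The corner 0 keeps the border column fixed when border-row multiples are added to other
  rows, and likewise with rows and columns exchanged.\<close>

lemma det_bordered_add_multiples:
  fixes r w s t :: "nat \<Rightarrow> 'a :: comm_ring_1"
  shows "det (bordered n 0 r w (\<lambda>j k. g j k + s j * r k + t k * w j)) = det (bordered n 0 r w g)"
  using det_bordered_row_op[of n 1 0 r w s g]
    det_bordered_col_op[of n 1 0 r t w "\<lambda>j k. g j k + s j * r k"]
  by simp

text \<open>Border the updated matrix by corner 1, row \<open>- x * r k\<close> and a zero column,
  which keeps its determinant. One row operation moves the update into the border column as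
  \<open>w\<close>, and splitting off the corner 1 gives both terms.\<close>

lemma det_rank_one_update:
  fixes x :: "'a :: comm_ring_1"
  shows "det (mat n n (\<lambda>(j, k). g j k + x * (w j * r k))) =
     det (mat n n (\<lambda>(j, k). g j k)) - x * det (bordered n 0 r w g)"
proof -
  have "det (mat n n (\<lambda>(j, k). g j k + x * (w j * r k))) =
      det (bordered n 1 (\<lambda>k. - x * r k) (\<lambda>_. 0) (\<lambda>j k. g j k + x * (w j * r k)))"
    using det_bordered_corner[of n 1 0 "\<lambda>k. - x * r k" "\<lambda>_. 0"
        "\<lambda>j k. g j k + x * (w j * r k)"]
      det_bordered_scale[of n 1 "\<lambda>k. - x * r k" 0 "\<lambda>_. 0" "\<lambda>j k. g j k + x * (w j * r k)"]
    by simp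
  also have "\<dots> = det (bordered n 1 (\<lambda>k. - x * r k) w g)"
    using det_bordered_row_op[of n 1 1 "\<lambda>k. - x * r k" w "\<lambda>j. - w j" g]
    by (simp add: mult_ac)
  also have "\<dots> = det (mat n n (\<lambda>(j, k). g j k)) - x * det (bordered n 0 r w g)"
    using det_bordered_corner[of n 1 0 "\<lambda>k. - x * r k" w g]
      det_bordered_scale[of n "- x" r 1 w g]
    by simp
  finally show ?thesis .
qed

text \<open>Subtracting the border row from all other rows, then the border column from all other
  columns, leaves \<open>x\<close> only in the corner and turns the core into \<open>?h\<close>. The
  corner is then split off.\<close>

lemma det_bordered_shift:
  fixes A B x y z :: "'a :: comm_ring_1"
  shows "det (bordered n x (\<lambda>k. x + (B + z) * r k) (\<lambda>j. x + (A + y) * w j)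
       (\<lambda>j k. x + g j k + y * w j + z * r k)) =
     x * det (mat n n (\<lambda>(j, k). g j k - A * w j - B * r k)) +
     (A + y) * (B + z) * det (bordered n 0 r w g)"
proof -
  let ?h = "\<lambda>j k. g j k - A * w j - B * r k"
  have "det (bordered n x (\<lambda>k. x + (B + z) * r k) (\<lambda>j. x + (A + y) * w j)
       (\<lambda>j k. x + g j k + y * w j + z * r k)) =
      det (bordered n x (\<lambda>k. x + (B + z) * r k) (\<lambda>j. (A + y) * w j)
       (\<lambda>j k. g j k + y * w j - B * r k))"
    using det_bordered_row_op[of n 1 x "\<lambda>k. x + (B + z) * r k" "\<lambda>j. (A + y) * w j" "\<lambda>_. 1"
       "\<lambda>j k. g j k + y * w j - B * r k"]
    by (simp add: algebra_simps)
  also have "\<dots> = det (bordered n x (\<lambda>k. (B + z) * r k) (\<lambda>j. (A + y) * w j) ?h)"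
    using det_bordered_col_op[of n 1 x "\<lambda>k. (B + z) * r k" "\<lambda>_. 1" "\<lambda>j. (A + y) * w j" ?h]
    by (simp add: algebra_simps)
  also have "\<dots> = x * det (mat n n (\<lambda>(j, k). ?h j k)) +
      (A + y) * (B + z) * det (bordered n 0 r w ?h)"
    using det_bordered_corner[of n x 0 _ _ ?h] det_bordered_scale[of n "B + z" r "A + y" w ?h]
    by simp
  \<comment> \<open>\<open>?h\<close> differs from \<open>g\<close> only by multiples of the border
    row and column.\<close>
  also have "det (bordered n 0 r w ?h) = det (bordered n 0 r w g)"
    using det_bordered_add_multiples[of n r w g "\<lambda>_. - B" "\<lambda>_. - A"]
    by (simp add: algebra_simps)
  finally show ?thesis .
qed

text \<open>Euler's criterion makes both sides congruent modulo \<open>p\<close>; both lie in {-1,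
  0, 1}, so they differ by at most 2, which is less than \<open>p\<close>.\<close>

lemma Legendre_mult:
  assumes "prime p" "odd p"
  shows "Legendre (a * b) (int p) = Legendre a (int p) * Legendre b (int p)"
proof -
  have p2: "2 < p"
    using assms prime_ge_2_nat[of p] by (cases "p = 2") auto
  note ec = euler_criterion[OF assms(1) p2]
  have "[Legendre a (int p) * Legendre b (int p) = (a * b) ^ ((p - 1) div 2)] (mod int p)"
    unfolding power_mult_distrib by (rule cong_mult[OF ec ec])
  from cong_trans[OF ec cong_sym[OF this]]
  have "int p dvd Legendre (a * b) (int p) - Legendre a (int p) * Legendre b (int p)"
    unfolding cong_iff_dvd_diff .
  moreover have "\<bar>Legendre (a * b) (int p) - Legendre a (int p) * Legendre b (int p)\<bar> < int p"
  proof -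
    have "Legendre t (int p) \<in> {-1, 0, 1}" for t
      by (simp add: Legendre_def)
    from this[of "a * b"] this[of a] this[of b] show ?thesis
      using p2 by auto
  qed
  ultimately show ?thesis
    using dvd_imp_le_int[of "Legendre (a * b) (int p) - Legendre a (int p) * Legendre b (int p)" "int p"]
    by linarith
qed

lemma Legendre_zero [simp]: "Legendre 0 q = 0"
  by (simp add: Legendre_def)

lemma leg_form_zero_right:
  assumes "prime p" "odd p"
  shows "leg_form p m c a b j 0 = leg_sum p m c a * legendre_symb j p"
  by (simp add: leg_form_def leg_sum_def Legendre_mult[OF assms] sum_distrib_left mult_ac)

lemma leg_form_zero_left:
  assumes "prime p" "odd p"
  shows "leg_form p m c a b 0 k = leg_sum p m c b * legendre_symb k p"
  by (simp add: leg_form_def leg_sum_def Legendre_mult[OF assms] sum_distrib_left mult_ac)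

lemma det_range_0_eq_bordered:
  "det_range 0 n g = det (bordered n (g 0 0) (\<lambda>k. g 0 (int (Suc k))) (\<lambda>j. g (int (Suc j)) 0)
     (\<lambda>j k. g (int (Suc j)) (int (Suc k))))"
  using mat_eq_bordered[of n "\<lambda>j k. g (int j) (int k)"]
  by (simp add: det_range_def)

lemma det_range_1_eq:
  "det_range 1 n g = det (mat n n (\<lambda>(j, k). g (int (Suc j)) (int (Suc k))))"
  by (simp add: det_range_def)

theorem theorem1p2:
  fixes p m :: nat
    and a b :: "nat \<Rightarrow> int"
    and cs :: "nat \<Rightarrow> complex"
    and c x y z :: complex
    and f :: "int \<Rightarrow> int \<Rightarrow> complex"
  assumes "prime p" and "odd p"
    and c_eq: "c = leg_sum p m cs a * leg_sum p m cs b"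
    and f_eq: "f = leg_form p m cs a b"
  shows
    "(\<forall>n \<in> {1..p - 1}.
        det_range 0 n (\<lambda>j k. f j k + legendre_symb (j * k) p * x) = det_range 0 n f \<and>
        c * det_range 1 n (\<lambda>j k. f j k + legendre_symb (j * k) p * x) =
          c * det_range 1 n f - x * det_range 0 n f) \<and>
     (\<forall>n::nat. n \<ge> 1 \<longrightarrow>
        c * det_range 0 n
              (\<lambda>j k. x + f j k + legendre_symb j p * y + legendre_symb k p * z) =
          (y + leg_sum p m cs a) * (z + leg_sum p m cs b) * det_range 0 n f +
          c * x * det_range 1 n
              (\<lambda>j k. f j k - leg_sum p m cs a * legendre_symb j p
                          - leg_sum p m cs b * legendre_symb k p))"
proof -
  define A where "A = leg_sum p m cs a"
  define B where "B = leg_sum p m cs b"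
  \<comment> \<open>Core indices start at 0, so \<open>Suc j\<close> runs through the integers 1,
    ..., n.\<close>
  define u where "u = (\<lambda>j. legendre_symb (int (Suc j)) p)"
  define M where "M = (\<lambda>j k. f (int (Suc j)) (int (Suc k)))"
  have c: "c = A * B"
    by (simp add: c_eq A_def B_def)
  have f_right: "f j 0 = A * legendre_symb j p" and f_left: "f 0 j = B * legendre_symb j p" for j
    using assms(1,2) by (simp_all add: f_eq A_def B_def leg_form_zero_right leg_form_zero_left)
  have mult: "legendre_symb (j * k) p = legendre_symb j p * legendre_symb k p" for j k
    using assms(1,2) by (simp add: Legendre_mult)
  \<comment> \<open>The corner \<open>f 0 0\<close> is 0 because the Legendre symbol of 0 is, so
    \<open>B\<close> and \<open>A\<close> can be pulled out of the border. This also covers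
    \<open>c = 0\<close>.\<close>
  have D0: "det_range 0 n f = c * det (bordered n 0 u u M)" for n
    using det_bordered_scale[of n B u A u M]
    by (simp add: det_range_0_eq_bordered f_right f_left c M_def u_def)
  have i0: "det_range 0 n (\<lambda>j k. f j k + legendre_symb (j * k) p * x) = det_range 0 n f" for n
  proof -
    \<comment> \<open>The symbol of \<open>j * k\<close> vanishes when an index is 0, so the extra
      term changes only the core, and there by a multiple of the border row.\<close>
    have "det_range 0 n (\<lambda>j k. f j k + legendre_symb (j * k) p * x) =
        det (bordered n 0 (\<lambda>k. B * u k) (\<lambda>j. A * u j) (\<lambda>j k. M j k + u j * u k * x))"
      unfolding det_range_0_eq_bordered mult by (simp add: f_right f_left M_def u_def)
    also have "\<dots> = c * det (bordered n 0 u u (\<lambda>j k. M j k + u j * u k * x))"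
      by (simp add: det_bordered_scale c)
    also have "det (bordered n 0 u u (\<lambda>j k. M j k + u j * u k * x)) = det (bordered n 0 u u M)"
      using det_bordered_add_multiples[of n u u M "\<lambda>j. x * u j" "\<lambda>_. 0"] by (simp add: mult_ac)
    finally show ?thesis by (simp add: D0)
  qed
  have i1: "c * det_range 1 n (\<lambda>j k. f j k + legendre_symb (j * k) p * x) =
      c * det_range 1 n f - x * det_range 0 n f" for n
  proof -
    have "det_range 1 n (\<lambda>j k. f j k + legendre_symb (j * k) p * x) =
        det (mat n n (\<lambda>(j, k). M j k + x * (u j * u k)))"
      unfolding det_range_1_eq mult by (simp add: M_def u_def mult_ac)
    also have "\<dots> = det_range 1 n f - x * det (bordered n 0 u u M)"
      unfolding det_rank_one_update det_range_1_eq M_def ..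
    \<comment> \<open>Multiplying by \<open>c\<close> turns the bordered determinant into that of
      \<open>f\<close> on 0, ..., n.\<close>
    finally show ?thesis by (simp only: D0 right_diff_distrib mult.left_commute)
  qed
  have ii: "c * det_range 0 n
        (\<lambda>j k. x + f j k + legendre_symb j p * y + legendre_symb k p * z) =
      (y + A) * (z + B) * det_range 0 n f +
      c * x * det_range 1 n (\<lambda>j k. f j k - A * legendre_symb j p - B * legendre_symb k p)" for n
  proof -
    \<comment> \<open>On the border one of the two symbols is 0, while \<open>f\<close> contributes
      \<open>A * u j\<close> or \<open>B * u k\<close>; this gives the coefficients
      \<open>A + y\<close> and \<open>B + z\<close>.\<close>
    have "det_range 0 n (\<lambda>j k. x + f j k + legendre_symb j p * y + legendre_symb k p * z) =
        det (bordered n x (\<lambda>k. x + (B + z) * u k) (\<lambda>j. x + (A + y) * u j)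
          (\<lambda>j k. x + M j k + y * u j + z * u k))"
      unfolding det_range_0_eq_bordered by (simp add: f_right f_left M_def u_def algebra_simps)
    also have "\<dots> = x * det (mat n n (\<lambda>(j, k). M j k - A * u j - B * u k)) +
        (A + y) * (B + z) * det (bordered n 0 u u M)"
      by (rule det_bordered_shift)
    also have "det (mat n n (\<lambda>(j, k). M j k - A * u j - B * u k)) =
        det_range 1 n (\<lambda>j k. f j k - A * legendre_symb j p - B * legendre_symb k p)"
      unfolding det_range_1_eq M_def u_def ..
    finally show ?thesis by (simp add: D0 algebra_simps)
  qed
  show ?thesis
    using i0 i1 ii by (simp add: A_def B_def)
qed

end
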